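(* Let $k$, $n$ and $s$ be positive integers and let $x_1,\ldots,x_n$ be independent variables. Then $$H_k^{(s)}(x_1,\ldots,x_n)=\begin{cases}\sum_{T\in\mathcal T_{n,k}^s}X^{w_T}, & \text{if } s \text{ is odd},\\[2pt] (-1)^k\sum_{T\in\mathcal T_{n,k}^s}(-1)^{G(T)}X^{w_T}, & \text{otherwise},\end{cases}$$ where $G(T)=\sum_{m=0}^{n-1}n_m(T)$.
   Context: For a positive integer $s$, $H_k^{(s)}$ ($k\ge0$) is defined by $\sum_{k\ge0}H_k^{(s)}(x_1,\ldots,x_n)t^k=\prod_{i=1}^n\big(1-x_it+\cdots+(-x_it)^s\big)^{-1}$. A tiling of an $(n+k-1)$-board with $k$ red and $n-1$ green squares is a word of length $n+k-1$ with exactly $k$ letters r (red) and $n-1$ letters g (green). For $m=0,1,\ldots,n-1$ let $b_m(T)$ be the number of consecutive red squares immediately following the $m$-th green square (for $m=0$: the red squares before the first green square); these may be $0$. $\mathcal T_{n,k}^s$ is the set of such tilings with $b_m(T)\equiv0$ or $1\pmod{s+1}$ for all $m$. Each red square with exactly $m$ green squares to its left gets weight $x_{m+1}$, green squares get weight $1$, and $X^{w_T}$ is the product of the weights of all squares of $T$. $n_m(T)$ is the least nonnegative residue of $b_m(T)$ modulo $s+1$. *)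

theory Defs
  imports "HOL-Computational_Algebra.Formal_Power_Series" "HOL-Library.Poly_Mapping"
begin

text \<open>Polynomials over \<open>'a\<close> in the independent variables \<open>x\<^sub>0, x\<^sub>1, x\<^sub>2, \<dots>\<close>: finitely supported
  functions from monomials (exponent vectors) to coefficients.\<close>

type_synonym 'a mpoly = "(nat \<Rightarrow>\<^sub>0 nat) \<Rightarrow>\<^sub>0 'a"

definition var :: "nat \<Rightarrow> 'a::comm_ring_1 mpoly" where
  "var i = Poly_Mapping.single (Poly_Mapping.single i 1) 1"

text \<open>The series \<open>1 - x t + \<dots> + (- x t)\<^sup>s\<close> in \<open>t\<close>.  It has constant term 1, so it is invertible over
  any commutative ring; the \<open>inverse\<close> operation on power series is not available here because it
  needs a division operation on the coefficients.\<close>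

definition factor_series :: "nat \<Rightarrow> 'r::comm_ring_1 \<Rightarrow> 'r fps" where
  "factor_series s x = (\<Sum>j=0..s. (- (fps_const x * fps_X)) ^ j)"

definition inv_factor_series :: "nat \<Rightarrow> 'r::comm_ring_1 \<Rightarrow> 'r fps" where
  "inv_factor_series s x = fps_right_inverse (factor_series s x) 1"

lemma factor_series_nth_0: "fps_nth (factor_series s x) 0 = 1"
proof -
  have "fps_nth (factor_series s x) 0 = (\<Sum>j=0..s. 0 ^ j)"
    by (simp add: factor_series_def fps_sum_nth fps_nth_power_0)
  also have "\<dots> = 1"
    by (simp add: sum.atLeast_Suc_atMost power_0_left)
  finally show ?thesis .
qed

lemma factor_series_mult_inv: "factor_series s x * inv_factor_series s x = 1"
  unfolding inv_factor_series_def
  by (rule fps_right_inverse) (simp add: factor_series_nth_0)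

definition H :: "nat \<Rightarrow> nat \<Rightarrow> (nat \<Rightarrow> 'r::comm_ring_1) \<Rightarrow> nat \<Rightarrow> 'r" where
  "H s n x k = fps_nth (\<Prod>i=1..n. inv_factor_series s (x i)) k"

datatype square = Red | Green

definition tilings :: "nat \<Rightarrow> nat \<Rightarrow> square list set" where
  "tilings n k = {T. length T = n + k - 1 \<and> count_list T Red = k \<and> count_list T Green = n - 1}"

text \<open>The part of the board strictly to the right of the \<open>m\<close>-th green square; the whole board for
  \<open>m = 0\<close>.\<close>

fun after_green :: "nat \<Rightarrow> square list \<Rightarrow> square list" where
  "after_green 0 T = T"
| "after_green (Suc m) T = after_green m (tl (dropWhile (\<lambda>c. c \<noteq> Green) T))"

definition b :: "nat \<Rightarrow> square list \<Rightarrow> nat" where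
  "b m T = length (takeWhile (\<lambda>c. c = Red) (after_green m T))"

definition restricted_tilings :: "nat \<Rightarrow> nat \<Rightarrow> nat \<Rightarrow> square list set" where
  "restricted_tilings s n k =
     {T \<in> tilings n k. \<forall>m\<in>{0..n-1}. b m T mod (s + 1) = 0 mod (s + 1) \<or>
                                    b m T mod (s + 1) = 1 mod (s + 1)}"

lemma finite_restricted_tilings: "finite (restricted_tilings s n k)"
proof (rule finite_subset)
  have "(UNIV :: square set) = {Red, Green}"
    using square.exhaust by auto
  then have "finite (UNIV :: square set)"
    by (metis finite.emptyI finite.insertI)
  then show "finite {T :: square list. set T \<subseteq> UNIV \<and> length T = n + k - 1}"
    by (rule finite_lists_length_eq)
qed (auto simp: restricted_tilings_def tilings_def)

definition weight :: "(nat \<Rightarrow> 'r::comm_ring_1) \<Rightarrow> square list \<Rightarrow> 'r" where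
  "weight x T = (\<Prod>i<length T. if T ! i = Red then x (count_list (take i T) Green + 1) else 1)"

definition residue_count :: "nat \<Rightarrow> nat \<Rightarrow> square list \<Rightarrow> nat" where
  "residue_count s m T = b m T mod (s + 1)"

definition G :: "nat \<Rightarrow> nat \<Rightarrow> square list \<Rightarrow> nat" where
  "G s n T = (\<Sum>m=0..n-1. residue_count s m T)"

end

theory Submission
  imports Defs
begin

text \<open>Since \<open>(1 + x t) (1 - x t + \<dots> + (- x t)\<^sup>s) = 1 - (- x t)\<^sup>s\<^sup>+\<^sup>1\<close>, each factor of the generating
  function is \<open>(1 + x t) / (1 - (- x t)\<^sup>s\<^sup>+\<^sup>1)\<close>, whose coefficient at \<open>t\<^sup>j\<close> vanishes unless \<open>j\<close> is
  congruent to 0 or 1 modulo \<open>s + 1\<close> and is \<open>\<plusminus> x\<^sup>j\<close> otherwise.  The coefficient at \<open>t\<^sup>k\<close> of a product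
  of \<open>n\<close> series is a sum over the ways to write \<open>k\<close> as an ordered sum of \<open>n\<close> exponents, that is, over
  the tilings, the exponents being the lengths of the red runs.\<close>

lemma b_replicate_Green_0 [simp]: "b 0 (replicate j Red @ Green # T) = j"
  by (induction j) (simp_all add: b_def)

lemma b_replicate_Green_Suc [simp]: "b (Suc m) (replicate j Red @ Green # T) = b m T"
  by (induction j) (simp_all add: b_def)

lemma after_green_replicate_Green [simp]:
  "after_green (Suc 0) (replicate j Red @ Green # T) = T"
  by (induction j) simp_all

lemma count_list_replicate_square [simp]:
  "count_list (replicate j Red) Red = j" "count_list (replicate j Red) Green = 0"
  by (induction j) simp_all

lemma length_eq_count_squares: "length T = count_list T Red + count_list T Green"
proof (induction T)
  case (Cons c T)
  then show ?case by (cases c) simp_all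
qed simp

lemma mem_tilings_Suc_iff:
  "T \<in> tilings (Suc n) k \<longleftrightarrow> count_list T Red = k \<and> count_list T Green = n"
  using length_eq_count_squares[of T] by (auto simp: tilings_def)

lemma no_Green_eq_replicate:
  "count_list T Green = 0 \<Longrightarrow> T = replicate (count_list T Red) Red"
proof (induction T)
  case (Cons c T)
  then show ?case by (cases c) simp_all
qed simp

lemma split_first_Green:
  assumes "count_list T Green = Suc n"
  obtains j T' where "T = replicate j Red @ Green # T'"
proof -
  have "\<exists>j T'. T = replicate j Red @ Green # T'"
    using assms
  proof (induction T)
    case (Cons c T)
    show ?case
    proof (cases c)
      case Red
      then obtain j T' where "T = replicate j Red @ Green # T'"
        using Cons by auto
      then have "c # T = replicate (Suc j) Red @ Green # T'"
        using Red by simp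
      then show ?thesis by blast
    next
      case Green
      then have "c # T = replicate 0 Red @ Green # T" by simp
      then show ?thesis by blast
    qed
  qed simp
  then show ?thesis using that by blast
qed

lemma tilings_1: "tilings (Suc 0) k = {replicate k Red}"
  using no_Green_eq_replicate by (auto simp: mem_tilings_Suc_iff)

lemma finite_tilings: "finite (tilings n k)"
proof (rule finite_subset)
  show "tilings n k \<subseteq> {T. set T \<subseteq> {Red, Green} \<and> length T = n + k - 1}"
    using square.exhaust by (auto simp: tilings_def)
qed (simp add: finite_lists_length_eq)

lemma sum_tilings_Suc_Suc:
  fixes g :: "square list \<Rightarrow> 'r::comm_monoid_add"
  shows "(\<Sum>T\<in>tilings (Suc (Suc n)) k. g T) =
    (\<Sum>j=0..k. \<Sum>T\<in>tilings (Suc n) (k - j). g (replicate j Red @ Green # T))"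
proof -
  have "(\<Sum>T\<in>tilings (Suc (Suc n)) k. g T) =
    (\<Sum>(j, T)\<in>(SIGMA j:{0..k}. tilings (Suc n) (k - j)). g (replicate j Red @ Green # T))"
  proof (rule sum.reindex_bij_witness[where j = "\<lambda>T. (b 0 T, after_green (Suc 0) T)"
        and i = "\<lambda>(j, T). replicate j Red @ Green # T"], goal_cases)
    case (1 T)
    then obtain j T' where "T = replicate j Red @ Green # T'"
      by (auto simp: mem_tilings_Suc_iff elim: split_first_Green)
    then show ?case by (simp del: after_green.simps)
  next
    case (2 T)
    then obtain j T' where "T = replicate j Red @ Green # T'"
      by (auto simp: mem_tilings_Suc_iff elim: split_first_Green)
    then show ?case using 2 by (auto simp: mem_tilings_Suc_iff simp del: after_green.simps)
  next
    case (5 T)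
    then obtain j T' where "T = replicate j Red @ Green # T'"
      by (auto simp: mem_tilings_Suc_iff elim: split_first_Green)
    then show ?case by (simp del: after_green.simps)
  qed (auto simp: mem_tilings_Suc_iff simp del: after_green.simps)
  also have "\<dots> = (\<Sum>j=0..k. \<Sum>T\<in>tilings (Suc n) (k - j). g (replicate j Red @ Green # T))"
    by (rule sum.Sigma[symmetric]) (simp_all add: finite_tilings)
  finally show ?thesis .
qed

lemma fps_prod_nth_tilings:
  fixes F :: "nat \<Rightarrow> 'r::comm_ring_1 fps"
  shows "fps_nth (\<Prod>i\<le>n. F i) k = (\<Sum>T\<in>tilings (Suc n) k. \<Prod>m\<le>n. fps_nth (F m) (b m T))"
proof (induction n arbitrary: F k)
  case 0
  have "takeWhile (\<lambda>c. c = Red) (replicate k Red) = replicate k Red" by simp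
  then show ?case by (simp add: tilings_1 b_def)
next
  case (Suc n)
  have "fps_nth (\<Prod>i\<le>Suc n. F i) k = fps_nth (F 0 * (\<Prod>i\<le>n. F (Suc i))) k"
    by (simp only: prod.atMost_Suc_shift)
  also have "\<dots> = (\<Sum>j=0..k. fps_nth (F 0) j *
      (\<Sum>T\<in>tilings (Suc n) (k - j). \<Prod>m\<le>n. fps_nth (F (Suc m)) (b m T)))"
    by (simp add: fps_mult_nth Suc.IH)
  also have "\<dots> = (\<Sum>T\<in>tilings (Suc (Suc n)) k. \<Prod>m\<le>Suc n. fps_nth (F m) (b m T))"
    by (simp add: sum_tilings_Suc_Suc prod.atMost_Suc_shift sum_distrib_left del: prod.atMost_Suc)
  finally show ?case .
qed

lemma weight_Cons:
  "weight x (c # T) =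
    (if c = Red then x 1 * weight x T else weight (\<lambda>i. x (Suc i)) T)"
  by (cases c)
    (simp_all add: weight_def prod.lessThan_Suc_shift del: prod.lessThan_Suc cong: if_cong)

lemma weight_eq_prod_b:
  "count_list T Green = n \<Longrightarrow> weight x T = (\<Prod>m\<le>n. x (Suc m) ^ b m T)"
proof (induction T arbitrary: x n)
  case Nil
  then show ?case by (simp add: weight_def b_def)
next
  case (Cons c T)
  show ?case
  proof (cases c)
    case Red
    have "b 0 (c # T) = Suc (b 0 T)" "b (Suc m) (c # T) = b (Suc m) T" for m
      using Red by (simp_all add: b_def)
    then show ?thesis
      using Cons Red by (cases n) (simp_all add: weight_Cons prod.atMost_Suc_shift mult.assoc
          del: prod.atMost_Suc)
  next
    case Green
    have "b 0 (c # T) = 0" "b (Suc m) (c # T) = b m T" for m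
      using Green by (simp_all add: b_def)
    then show ?thesis
      using Cons Green by (cases n) (simp_all add: weight_Cons prod.atMost_Suc_shift
          del: prod.atMost_Suc)
  qed
qed

definition factor_sign :: "nat \<Rightarrow> nat \<Rightarrow> 'r::comm_ring_1" where
  "factor_sign s j = (if j mod (s + 1) \<in> {0, 1}
     then if odd s then 1 else (- 1) ^ j * (- 1) ^ (j mod (s + 1)) else 0)"

lemma factor_series_mult_linear:
  "factor_series s x * (1 + fps_const x * fps_X) = 1 - fps_const ((- x) ^ (s + 1)) * fps_X ^ (s + 1)"
proof -
  let ?y = "- (fps_const x * fps_X)"
  have "factor_series s x * (1 + fps_const x * fps_X) = (1 - ?y) * (\<Sum>j\<le>s. ?y ^ j)"
    by (simp add: factor_series_def atLeast0AtMost mult.commute)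
  also have "\<dots> = 1 - ?y ^ (s + 1)"
    by (simp only: sum_gp_basic Suc_eq_plus1)
  also have "?y = fps_const (- x) * fps_X"
    by (simp only: fps_const_neg[symmetric] minus_mult_left)
  finally show ?thesis
    by (simp only: power_mult_distrib fps_const_power)
qed

lemma factor_sign_periodic:
  "factor_sign s (j + (s + 1)) = (- 1) ^ (s + 1) * factor_sign s j"
  unfolding factor_sign_def mod_add_self2 by (simp add: power_add mult_ac)

lemma factor_sign_series:
  fixes x :: "'r::comm_ring_1"
  assumes "s > 0"
  shows "(1 - fps_const ((- x) ^ (s + 1)) * fps_X ^ (s + 1)) *
    Abs_fps (\<lambda>j. factor_sign s j * x ^ j) = 1 + fps_const x * fps_X"
    (is "?L = ?R")
proof (rule fps_ext)
  fix j
  let ?A = "Abs_fps (\<lambda>j. factor_sign s j * x ^ j)"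
  have L: "fps_nth ?L j = factor_sign s j * x ^ j -
      (if j < s + 1 then 0 else (- x) ^ (s + 1) * (factor_sign s (j - (s + 1)) * x ^ (j - (s + 1))))"
    by (simp only: left_diff_distrib mult.assoc fps_sub_nth fps_mult_left_const_nth
        fps_X_power_mult_nth mult_1_left fps_nth_Abs_fps) simp
  have R: "fps_nth ?R j = (if j = 0 then 1 else if j = 1 then x else 0)"
    by (cases j) (simp_all add: fps_X_def)
  show "fps_nth ?L j = fps_nth ?R j"
  proof (cases "j < s + 1")
    case True
    then show ?thesis
      unfolding L R using assms by (auto simp: factor_sign_def)
  next
    case False
    then obtain i where j: "j = i + (s + 1)"
      by (metis le_add_diff_inverse2 not_less)
    have "factor_sign s j * x ^ j = (- x) ^ (s + 1) * (factor_sign s i * x ^ i)"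
      unfolding j factor_sign_periodic power_add[of x i] power_minus[of x]
      by (simp only: mult_ac)
    then have "fps_nth ?L j = 0"
      unfolding L using j by simp
    moreover have "fps_nth ?R j = 0"
      unfolding R unfolding j using assms by simp
    ultimately show ?thesis by simp
  qed
qed

lemma inv_factor_series_eq:
  fixes x :: "'r::comm_ring_1"
  assumes "s > 0"
  shows "inv_factor_series s x = Abs_fps (\<lambda>j. factor_sign s j * x ^ j)" (is "_ = ?A")
proof -
  let ?P = "factor_series s x" and ?I = "inv_factor_series s x"
  let ?l = "1 + fps_const x * fps_X"
  obtain g where g: "?l * g = 1"
    using fps_right_inverse[of ?l 1] by auto
  have "?l * (?P * ?A) = ?l"
    using factor_sign_series[OF assms, of x] factor_series_mult_linear[of s x]
    by (metis mult.assoc mult.commute)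
  then have "g * ?l * (?P * ?A) = g * ?l"
    by (simp only: mult.assoc)
  then have "?P * ?A = 1"
    using g by (simp add: mult.commute)
  then have "?I * (?P * ?A) = ?I" by simp
  moreover have "?I * ?P = 1"
    using factor_series_mult_inv[of s x] by (simp only: mult.commute)
  ultimately show ?thesis
    by (simp only: mult.assoc[symmetric] mult_1_left)
qed

lemma H_eq_sum_tilings:
  fixes x :: "nat \<Rightarrow> 'r::comm_ring_1"
  assumes "s > 0"
  shows "H s (Suc n) x k =
    (\<Sum>T\<in>tilings (Suc n) k. (\<Prod>m\<le>n. factor_sign s (b m T)) * weight x T)"
proof -
  have "H s (Suc n) x k =
      fps_nth (\<Prod>i\<le>n. Abs_fps (\<lambda>j. factor_sign s j * x (Suc i) ^ j)) k"
    unfolding H_def inv_factor_series_eq[OF assms] One_nat_def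
    by (simp only: prod.shift_bounds_cl_Suc_ivl atLeast0AtMost)
  also have "\<dots> = (\<Sum>T\<in>tilings (Suc n) k. \<Prod>m\<le>n. factor_sign s (b m T) * x (Suc m) ^ b m T)"
    by (simp add: fps_prod_nth_tilings)
  also have "\<dots> = (\<Sum>T\<in>tilings (Suc n) k. (\<Prod>m\<le>n. factor_sign s (b m T)) * weight x T)"
    by (rule sum.cong) (simp_all add: mem_tilings_Suc_iff weight_eq_prod_b prod.distrib)
  finally show ?thesis .
qed

lemma sum_b_tilings: "count_list T Green = n \<Longrightarrow> (\<Sum>m\<le>n. b m T) = count_list T Red"
proof (induction n arbitrary: T)
  case 0
  then have "T = replicate (count_list T Red) Red"
    by (rule no_Green_eq_replicate)
  then have "b 0 T = b 0 (replicate (count_list T Red) Red)" by simp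
  then show ?case by (simp add: b_def)
next
  case (Suc n)
  from Suc.prems obtain j T' where "T = replicate j Red @ Green # T'"
    by (rule split_first_Green)
  then show ?case
    using Suc by (simp add: sum.atMost_Suc_shift del: sum.atMost_Suc)
qed

lemma prod_factor_sign:
  assumes "s > 0" and "T \<in> tilings (Suc n) k"
  shows "(\<Prod>m\<le>n. factor_sign s (b m T) :: 'r::comm_ring_1) =
    (if T \<in> restricted_tilings s (Suc n) k
     then if odd s then 1 else (- 1) ^ k * (- 1) ^ G s (Suc n) T else 0)"
proof (cases "T \<in> restricted_tilings s (Suc n) k")
  case True
  then have "\<forall>m\<le>n. b m T mod (s + 1) \<in> {0, 1}"
    using assms(1) by (auto simp: restricted_tilings_def)
  then have "(\<Prod>m\<le>n. factor_sign s (b m T) :: 'r) =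
      (\<Prod>m\<le>n. if odd s then 1 else (- 1) ^ b m T * (- 1) ^ (b m T mod (s + 1)))"
    by (intro prod.cong) (auto simp: factor_sign_def)
  also have "\<dots> = (if odd s then 1
      else (- 1) ^ (\<Sum>m\<le>n. b m T) * (- 1) ^ (\<Sum>m\<le>n. b m T mod (s + 1)))"
    by (simp add: power_sum prod.distrib)
  also have "(\<Sum>m\<le>n. b m T) = k"
    using assms(2) by (simp add: mem_tilings_Suc_iff sum_b_tilings)
  finally show ?thesis
    using True by (simp add: G_def residue_count_def atLeast0AtMost)
next
  case False
  then obtain m where "m \<le> n" "b m T mod (s + 1) \<notin> {0, 1}"
    using assms by (auto simp: restricted_tilings_def)
  then have "(\<Prod>m\<le>n. factor_sign s (b m T) :: 'r) = 0"
    by (intro prod_zero) (auto simp: factor_sign_def)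
  then show ?thesis using False by simp
qed

theorem theorem4p9:
  fixes k n s :: nat
  assumes "k > 0" and "n > 0" and "s > 0"
  shows "H s n (var :: nat \<Rightarrow> 'a::comm_ring_1 mpoly) k =
    (if odd s
     then (\<Sum>T\<in>restricted_tilings s n k. weight var T)
     else (- 1) ^ k * (\<Sum>T\<in>restricted_tilings s n k. (- 1) ^ G s n T * weight var T))"
proof -
  obtain n' where n: "n = Suc n'"
    using assms(2) by (cases n) auto
  let ?v = "var :: nat \<Rightarrow> 'a mpoly"
  let ?c = "\<lambda>T. if odd s then 1 else (- 1) ^ k * (- 1) ^ G s n T :: 'a mpoly"
  have sub: "restricted_tilings s n k \<subseteq> tilings n k"
    by (auto simp: restricted_tilings_def)
  have "H s n ?v k = (\<Sum>T\<in>tilings n k.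
      (if T \<in> restricted_tilings s n k then ?c T else 0) * weight ?v T)"
    unfolding n H_eq_sum_tilings[OF assms(3)]
    by (rule sum.cong) (simp_all add: prod_factor_sign[OF assms(3)])
  also have "\<dots> = (\<Sum>T\<in>restricted_tilings s n k. ?c T * weight ?v T)"
    by (rule sum.mono_neutral_cong_right[OF finite_tilings sub]) auto
  also have "\<dots> = (if odd s then (\<Sum>T\<in>restricted_tilings s n k. weight var T)
     else (- 1) ^ k * (\<Sum>T\<in>restricted_tilings s n k. (- 1) ^ G s n T * weight var T))"
    by (simp add: sum_distrib_left mult.assoc)
  finally show ?thesis .
qed

end
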